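(* Let $\zeta$ be a nonnegative integer-valued random variable with generating function $G(x)=\mathbb{E}(x^{\zeta})=\sum_{k=0}^\infty a_k x^k$, $0\le x\le 1$, where $a_k=P(\zeta=k)$. Then $\zeta$ is $p$-thickable for all $p\in(0,1)$ if and only if it has a Cox distribution (a mixture of Poisson distributions and the constant $0$), i.e. if and only if there exists a probability measure $Q$ on $[0,\infty)$ such that $$G(x)=\int_{[0,\infty)} \mathrm{e}^{t(x-1)}\, Q(\mathrm{d}t),\qquad 0\le x\le 1.$$
   Context: Let $\mathbb{N}_0=\{0,1,2,\ldots\}$. For a random variable $\zeta$ with values in $\mathbb{N}_0$ and $P(\zeta=k)=a_k$, where $a_k\ge 0$ and $\sum_{k=0}^\infty a_k=1$, the generating function $G:[0,1]\to[0,1]$ is $G(x)=\mathbb{E}(x^\zeta)=\sum_{k=0}^\infty a_k x^k$. The series $\sum_{k=0}^\infty a_k x^k$ is also considered for general $x\in\mathbb{R}$, and $G(x)$ denotes its value, if the value of this series is defined. Thickening: for $0<p<1$ put $G_{1/p}(x)=G\left(1-\frac1p+\frac1p x\right)$, if this is defined for all $0\le x\le 1$. The random variable $\zeta$ is called $p$-thickable if the function $G_{1/p}(x)=G\left(1-\frac1p+\frac1p x\right)$ is defined for all $x\in[0,1]$ and if it is the generating function of a nonnegative integer-valued random variable.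
   Formalization: In the definition of p-thickable, G on [1-1/p,1] is taken as the analytic continuation along the real axis (continuous at the end points), not as the value of the power series; with the series, the claim fails for the geometric law a_k=2^{-(k+1)}, which is Cox but not p-thickable for p≤1/3. *)

theory Defs
  imports "HOL-Probability.Probability" "HOL-Complex_Analysis.Complex_Analysis"
begin

definition gf :: "'a measure \<Rightarrow> ('a \<Rightarrow> nat) \<Rightarrow> real \<Rightarrow> real" where
  "gf M \<zeta> x = (\<Sum>k. \<P>(\<omega> in M. \<zeta> \<omega> = k) * x ^ k)"

lemma gf_sums_expectation:
  fixes \<zeta> :: "'a \<Rightarrow> nat" and x :: real
  assumes "prob_space M" and rv: "\<zeta> \<in> measurable M (count_space UNIV)" and x: "x \<in> {0..1}"
  shows "(\<lambda>k. \<P>(\<omega> in M. \<zeta> \<omega> = k) * x ^ k) sums (\<integral>\<omega>. x ^ \<zeta> \<omega> \<partial>M)"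
proof -
  interpret prob_space M by fact
  define f where "f = (\<lambda>k \<omega>. indicator {\<omega> \<in> space M. \<zeta> \<omega> = k} \<omega> * x ^ k)"
  have ev: "{\<omega> \<in> space M. \<zeta> \<omega> = k} \<in> sets M" for k
    using rv by measurable
  have int: "integrable M (f k)" for k
    unfolding f_def using ev by (intro integrable_mult_left integrable_real_indicator) (auto simp: emeasure_eq_measure)
  have val: "integral\<^sup>L M (f k) = \<P>(\<omega> in M. \<zeta> \<omega> = k) * x ^ k" for k
    unfolding f_def using ev by (simp add: sets.Int_space_eq2)
  have pt: "(\<lambda>k. f k \<omega>) sums (x ^ \<zeta> \<omega>)" if "\<omega> \<in> space M" for \<omega>
    using sums_single[of "\<zeta> \<omega>" "\<lambda>k. x ^ k"] that
    by (simp add: f_def indicator_def of_bool_def if_distrib[of "\<lambda>c. c * _"] eq_commute[of "\<zeta> \<omega>"] cong: if_cong)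
  have nn: "\<bar>f k \<omega>\<bar> = f k \<omega>" for k \<omega>
    using x by (simp add: f_def)
  have "disjoint_family (\<lambda>k. {\<omega> \<in> space M. \<zeta> \<omega> = k})"
    by (auto simp: disjoint_family_on_def)
  then have "(\<lambda>k. \<P>(\<omega> in M. \<zeta> \<omega> = k)) sums prob (\<Union>k. {\<omega> \<in> space M. \<zeta> \<omega> = k})"
    using ev by (intro finite_measure_UNION) auto
  then have "summable (\<lambda>k. \<P>(\<omega> in M. \<zeta> \<omega> = k))"
    by (rule sums_summable)
  then have summ: "summable (\<lambda>k. \<P>(\<omega> in M. \<zeta> \<omega> = k) * x ^ k)"
    by (rule summable_comparison_test'[where N = 0])
       (use x in \<open>auto simp: mult_left_le power_le_one\<close>)
  have "(\<lambda>k. integral\<^sup>L M (f k)) sums (\<integral>\<omega>. (\<Sum>k. f k \<omega>) \<partial>M)"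
    by (rule sums_integral)
       (use int pt summ in \<open>auto simp: nn val intro!: AE_I2 dest: sums_summable\<close>)
  also have "(\<integral>\<omega>. (\<Sum>k. f k \<omega>) \<partial>M) = (\<integral>\<omega>. x ^ \<zeta> \<omega> \<partial>M)"
    using pt by (intro Bochner_Integration.integral_cong) (auto simp: sums_iff)
  finally show ?thesis by (simp add: val)
qed

lemma gf_eq_expectation:
  fixes \<zeta> :: "'a \<Rightarrow> nat" and x :: real
  assumes "prob_space M" and "\<zeta> \<in> measurable M (count_space UNIV)" and "x \<in> {0..1}"
  shows "gf M \<zeta> x = (\<integral>\<omega>. x ^ \<zeta> \<omega> \<partial>M)"
  using gf_sums_expectation[OF assms] by (auto simp: gf_def sums_iff)

text \<open>
  The value of the generating function on \<open>[c, 1]\<close> for \<open>c < 0\<close>. The sum of the power series alone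
  is too narrow: the geometric law \<open>P(\<zeta> = k) = 2 ^ -(k + 1)\<close>, a mixture of Poisson laws with
  exponentially distributed parameter, has the generating function \<open>1 / (2 - x)\<close>, whose
  series diverges for \<open>x \<le> -2\<close>. The value is therefore taken to be that of the analytic continuation
  along the real axis. It is unique (lemma \<open>gf_extension_unique\<close>) and agrees with the sum of the
  series as far as the latter converges (lemmas \<open>gf_extension_gf\<close>, \<open>gf_extension_eq_gf\<close>).
\<close>

definition gf_extension :: "'a measure \<Rightarrow> ('a \<Rightarrow> nat) \<Rightarrow> real \<Rightarrow> (real \<Rightarrow> real) \<Rightarrow> bool" where
  "gf_extension M \<zeta> c G \<longleftrightarrow>
     continuous_on {c..1} G \<and>
     (\<exists>F. F analytic_on complex_of_real ` {c<..<1} \<and>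
        (\<forall>y\<in>{c<..<1}. F (complex_of_real y) = complex_of_real (G y))) \<and>
     (\<forall>y\<in>{0..1}. G y = gf M \<zeta> y)"

lemma gf_extension_unique:
  assumes "c < 0" and G: "gf_extension M \<zeta> c G" and H: "gf_extension M \<zeta> c H" and y: "y \<in> {c..1}"
  shows "G y = H y"
proof -
  obtain F1 where F1: "F1 analytic_on complex_of_real ` {c<..<1}"
    and eq1: "\<And>y. y \<in> {c<..<1} \<Longrightarrow> F1 (complex_of_real y) = complex_of_real (G y)"
    using G unfolding gf_extension_def by blast
  obtain F2 where F2: "F2 analytic_on complex_of_real ` {c<..<1}"
    and eq2: "\<And>y. y \<in> {c<..<1} \<Longrightarrow> F2 (complex_of_real y) = complex_of_real (H y)"
    using H unfolding gf_extension_def by blast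
  define I where "I = complex_of_real ` {c<..<1}"
  have "(\<lambda>z. F1 z - F2 z) analytic_on I"
    using F1 F2 unfolding I_def by (intro analytic_intros)
  then obtain S where S: "open S" "I \<subseteq> S" "(\<lambda>z. F1 z - F2 z) holomorphic_on S"
    by (auto simp: analytic_on_holomorphic)
  define T where "T = connected_component_set S 0"
  have "0 \<in> I" using \<open>c < 0\<close> by (auto simp: I_def image_iff)
  have "connected I" unfolding I_def by (intro connected_continuous_image continuous_intros) auto
  then have "I \<subseteq> T" unfolding T_def using \<open>0 \<in> I\<close> S(2) by (intro connected_component_maximal)
  have "open T" "connected T" "T \<subseteq> S"
    unfolding T_def using S(1) by (auto simp: open_connected_component connected_component_subset)
  have lim: "0 islimpt complex_of_real ` {0<..<1}"
  proof (unfold islimpt_approachable, intro allI impI)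
    fix e :: real assume "e > 0"
    define z where "z = min (e / 2) (1 / 2)"
    have "0 < z" "z < 1" "z < e" using \<open>e > 0\<close> by (auto simp: z_def)
    then show "\<exists>x'\<in>complex_of_real ` {0<..<1}. x' \<noteq> 0 \<and> dist x' 0 < e"
      by (intro bexI[of _ "complex_of_real z"]) auto
  qed
  have "F1 w - F2 w = 0" if "w \<in> T" for w
  proof (rule analytic_continuation[of "\<lambda>z. F1 z - F2 z" T "complex_of_real ` {0<..<1}" 0])
    show "(\<lambda>z. F1 z - F2 z) holomorphic_on T"
      using S(3) \<open>T \<subseteq> S\<close> by (rule holomorphic_on_subset)
    show "complex_of_real ` {0<..<1} \<subseteq> T"
      using \<open>I \<subseteq> T\<close> \<open>c < 0\<close> by (force simp: I_def)
    show "0 \<in> T" using \<open>0 \<in> I\<close> \<open>I \<subseteq> T\<close> by auto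
    fix z assume "z \<in> complex_of_real ` {0<..<1}"
    then obtain x where x: "z = complex_of_real x" "0 < x" "x < 1" by auto
    have "G x = H x" using G H x by (simp add: gf_extension_def)
    then show "F1 z - F2 z = 0" using eq1[of x] eq2[of x] x \<open>c < 0\<close> by simp
  qed (use \<open>open T\<close> \<open>connected T\<close> lim that in auto)
  then have inner: "G x = H x" if "x \<in> {c<..<1}" for x
    using eq1[OF that] eq2[OF that] \<open>I \<subseteq> T\<close> that by (force simp: I_def)
  have cont: "continuous_on {c..1} (\<lambda>x. G x - H x)"
    using G H by (intro continuous_intros) (auto simp: gf_extension_def)
  have clos: "closure {c<..<1} = {c..1}" using \<open>c < 0\<close> by (intro closure_greaterThanLessThan) auto
  have "G y - H y = 0"
    by (rule continuous_constant_on_closure[of "{c<..<1}" "\<lambda>x. G x - H x"])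
       (use cont clos y inner in auto)
  then show ?thesis by simp
qed

lemma Abel_limit:
  fixes b :: "nat \<Rightarrow> real"
  assumes "summable b"
  shows "continuous_on {0..1} (\<lambda>t. \<Sum>k. b k * t ^ k)"
proof -
  define T where "T = (\<lambda>n. \<Sum>k. b (k + n))"
  have T_lim: "T \<longlonglongrightarrow> 0"
    unfolding T_def by (rule suminf_exist_split2[OF assms])
  have T_Suc: "b n = T n - T (Suc n)" for n
    using suminf_split_head[OF summable_ignore_initial_segment[OF assms, of n]]
    by (simp add: T_def)
  have "uniformly_Cauchy_on {0..1} (\<lambda>n t. \<Sum>k<n. b k * t ^ k)"
  proof (rule uniformly_Cauchy_onI')
    fix e :: real assume "e > 0"
    then obtain N where N: "\<And>n. n \<ge> N \<Longrightarrow> \<bar>T n\<bar> < e / 4"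
      using LIMSEQ_D[OF T_lim, of "e / 4"] by auto
    show "\<exists>N. \<forall>t\<in>{0..1}. \<forall>m\<ge>N. \<forall>n>m. dist (\<Sum>k<m. b k * t ^ k) (\<Sum>k<n. b k * t ^ k) < e"
    proof (intro exI ballI allI impI)
      fix t :: real and m n :: nat assume t: "t \<in> {0..1}" and m: "N \<le> m" and "m < n"
      have Tb: "\<bar>T j * t ^ j\<bar> \<le> e / 4 * t ^ j" if "j \<ge> m" for j
      proof -
        have "\<bar>T j * t ^ j\<bar> = \<bar>T j\<bar> * t ^ j" using t by (simp add: abs_mult)
        also have "\<dots> \<le> e / 4 * t ^ j"
          using N[of j] that m t by (intro mult_right_mono) auto
        finally show ?thesis .
      qed
      have "\<bar>(\<Sum>k<n. b k * t ^ k) - (\<Sum>k<m. b k * t ^ k) + T n * t ^ n\<bar> \<le> e / 4 * (2 * t ^ m - t ^ n)"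
        using less_imp_le[OF \<open>m < n\<close>]
      proof (induction n rule: dec_induct)
        case base
        show ?case using Tb[of m] by simp
      next
        case (step n)
        have le: "t ^ Suc n \<le> t ^ n" using t power_decreasing[of n "Suc n" t] by simp
        have "\<bar>T (Suc n) * (t ^ n - t ^ Suc n)\<bar> = \<bar>T (Suc n)\<bar> * (t ^ n - t ^ Suc n)"
          using le by (simp only: abs_mult abs_of_nonneg diff_ge_0_iff_ge)
        also have "\<dots> \<le> e / 4 * (t ^ n - t ^ Suc n)"
          using N[of "Suc n"] step m le by (intro mult_right_mono) auto
        finally have 1: "\<bar>T (Suc n) * (t ^ n - t ^ Suc n)\<bar> \<le> e / 4 * (t ^ n - t ^ Suc n)" .
        have 2: "(\<Sum>k<Suc n. b k * t ^ k) - (\<Sum>k<m. b k * t ^ k) + T (Suc n) * t ^ Suc n =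
           ((\<Sum>k<n. b k * t ^ k) - (\<Sum>k<m. b k * t ^ k) + T n * t ^ n) - T (Suc n) * (t ^ n - t ^ Suc n)"
          unfolding sum.lessThan_Suc T_Suc[of n] by (simp only: algebra_simps)
        show ?case unfolding 2 using step.IH 1 by (simp only: algebra_simps abs_le_iff)
      qed
      moreover have "\<bar>T n * t ^ n\<bar> \<le> e / 4 * t ^ n"
        using Tb[of n] \<open>m < n\<close> by simp
      ultimately have "\<bar>(\<Sum>k<n. b k * t ^ k) - (\<Sum>k<m. b k * t ^ k)\<bar> \<le> e / 4 * (2 * t ^ m)"
        by (simp only: algebra_simps abs_le_iff) linarith
      also have "\<dots> \<le> e / 4 * (2 * 1)"
        using t \<open>e > 0\<close> by (intro mult_left_mono) (auto intro!: power_le_one)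
      also have "\<dots> < e" using \<open>e > 0\<close> by simp
      finally show "dist (\<Sum>k<m. b k * t ^ k) (\<Sum>k<n. b k * t ^ k) < e"
        by (simp add: dist_real_def abs_minus_commute)
    qed
  qed
  then have "uniformly_convergent_on {0..1} (\<lambda>n t. \<Sum>k<n. b k * t ^ k)"
    by (simp add: uniformly_convergent_eq_Cauchy)
  then have "uniform_limit {0..1} (\<lambda>n t. \<Sum>k<n. b k * t ^ k) (\<lambda>t. \<Sum>k. b k * t ^ k) sequentially"
    by (simp add: uniformly_convergent_uniform_limit_iff suminf_eq_lim)
  then show ?thesis
    by (rule uniform_limit_theorem[rotated]) (auto intro!: always_eventually continuous_intros)
qed

lemma Abel_limit_scaled:
  fixes a :: "nat \<Rightarrow> real"
  assumes "summable (\<lambda>k. a k * r ^ k)" and "r \<noteq> 0"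
  shows "continuous_on ((\<lambda>y. y / r) -` {0..1}) (\<lambda>y. \<Sum>k. a k * y ^ k)"
proof -
  have "continuous_on ((\<lambda>y. y / r) -` {0..1}) (\<lambda>y. \<Sum>k. a k * r ^ k * (y / r) ^ k)"
    by (rule continuous_on_compose2[OF Abel_limit[OF assms(1)]])
       (use assms(2) in \<open>auto intro!: continuous_intros\<close>)
  then show ?thesis using assms(2) by (simp add: power_divide)
qed

lemma gf_extension_gf:
  assumes "prob_space M" and rv: "\<zeta> \<in> measurable M (count_space UNIV)" and "c < 0"
    and conv: "summable (\<lambda>k. \<P>(\<omega> in M. \<zeta> \<omega> = k) * c ^ k)"
  shows "gf_extension M \<zeta> c (gf M \<zeta>)"
proof -
  define a where "a = (\<lambda>k. \<P>(\<omega> in M. \<zeta> \<omega> = k))"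
  have gf: "gf M \<zeta> = (\<lambda>y. \<Sum>k. a k * y ^ k)" by (auto simp: gf_def a_def)
  have c: "summable (\<lambda>k. a k * c ^ k)" using conv by (simp add: a_def)
  have 1: "summable (\<lambda>k. a k * 1 ^ k)"
    using gf_sums_expectation[OF assms(1,2), of 1] by (auto simp: a_def dest: sums_summable)
  have "{c..1} = {c..0} \<union> {0..1}" using \<open>c < 0\<close> by auto
  moreover have "continuous_on {c..0} (gf M \<zeta>)" unfolding gf
    by (rule continuous_on_subset[OF Abel_limit_scaled[OF c]])
       (use \<open>c < 0\<close> in \<open>auto simp: divide_simps\<close>)
  moreover have "continuous_on {0..1} (gf M \<zeta>)" unfolding gf
    using Abel_limit_scaled[OF 1] by (simp add: vimage_def)
  ultimately have cont: "continuous_on {c..1} (gf M \<zeta>)"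
    by (simp add: continuous_on_closed_Un)
  define F where "F = (\<lambda>z. \<Sum>k. complex_of_real (a k) * z ^ k)"
  have csum: "summable (\<lambda>k. complex_of_real (a k) * z ^ k)" if z: "norm z < max 1 \<bar>c\<bar>" for z
  proof (cases "norm z < 1")
    case True
    have "summable (\<lambda>k. complex_of_real (a k) * 1 ^ k)" using 1 by (simp flip: of_real_power of_real_mult)
    then show ?thesis by (rule powser_inside) (use True in simp)
  next
    case False
    have "summable (\<lambda>k. complex_of_real (a k) * complex_of_real c ^ k)"
      using c by (simp flip: of_real_power of_real_mult)
    then show ?thesis by (rule powser_inside) (use z False in auto)
  qed
  have "F holomorphic_on ball 0 (max 1 \<bar>c\<bar>)"
    by (rule power_series_holomorphic[of 0 _ "\<lambda>k. complex_of_real (a k)"])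
       (use csum in \<open>auto simp: F_def dest: summable_sums\<close>)
  moreover have sub: "complex_of_real ` {c<..<1} \<subseteq> ball 0 (max 1 \<bar>c\<bar>)"
    using \<open>c < 0\<close> by auto
  ultimately have an: "F analytic_on complex_of_real ` {c<..<1}"
    by (auto simp: analytic_on_holomorphic)
  have eq: "F (complex_of_real y) = complex_of_real (gf M \<zeta> y)" if "y \<in> {c<..<1}" for y
  proof -
    have "summable (\<lambda>k. complex_of_real (a k) * complex_of_real y ^ k)"
      using sub that by (intro csum) auto
    then have "summable (\<lambda>k. a k * y ^ k)" by (simp flip: of_real_power of_real_mult)
    then show ?thesis unfolding F_def gf by (simp add: suminf_of_real)
  qed
  show ?thesis unfolding gf_extension_def using cont an eq by blast
qed

lemma gf_extension_eq_gf:
  assumes "prob_space M" and "\<zeta> \<in> measurable M (count_space UNIV)" and G: "gf_extension M \<zeta> c G"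
    and y: "y \<in> {c..1}" and conv: "summable (\<lambda>k. \<P>(\<omega> in M. \<zeta> \<omega> = k) * y ^ k)"
  shows "G y = gf M \<zeta> y"
proof (cases "y < 0")
  case True
  have "gf_extension M \<zeta> y G" using G y unfolding gf_extension_def
    by (auto elim!: continuous_on_subset analytic_on_subset)
       (use y in \<open>force intro: analytic_on_subset\<close>)
  then show ?thesis
    using gf_extension_unique[OF True _ gf_extension_gf[OF assms(1,2) True conv], of G y] y by auto
next
  case False
  then show ?thesis using G y by (auto simp: gf_extension_def)
qed

text \<open>
  Laws of \<open>\<nat>\<close>-valued random variables are exactly the values of type \<^typ>\<open>nat pmf\<close>, and
  the identity is a random variable on \<open>measure_pmf q\<close> with law \<open>q\<close>.
\<close>

definition thickable :: "real \<Rightarrow> 'a measure \<Rightarrow> ('a \<Rightarrow> nat) \<Rightarrow> bool" where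
  "thickable p M \<zeta> \<longleftrightarrow>
     (\<exists>G. gf_extension M \<zeta> (1 - 1 / p) G \<and>
        (\<exists>q :: nat pmf. \<forall>x\<in>{0..1}. G (1 - 1 / p + 1 / p * x) = gf (measure_pmf q) (\<lambda>k. k) x))"

definition prob_measure_on_nonneg :: "real measure \<Rightarrow> bool" where
  "prob_measure_on_nonneg Q \<longleftrightarrow> prob_space Q \<and> sets Q = sets (restrict_space borel {0..})"

text \<open>The library's \<^const>\<open>poisson_pmf\<close> is only specified for positive rates.\<close>

definition poisson0_pmf :: "real \<Rightarrow> nat pmf" where
  "poisson0_pmf t = (if t = 0 then return_pmf 0 else poisson_pmf t)"

definition cox_distributed :: "'a measure \<Rightarrow> ('a \<Rightarrow> nat) \<Rightarrow> bool" where
  "cox_distributed M \<zeta> \<longleftrightarrow>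
     (\<exists>Q. prob_measure_on_nonneg Q \<and>
        (\<forall>k. \<P>(\<omega> in M. \<zeta> \<omega> = k) = (\<integral>t. pmf (poisson0_pmf t) k \<partial>Q)))"

end

theory Submission
  imports Defs
begin

text \<open>
  Everything rests on one reading of \<open>p\<close>-thickability. If the thickened generating function
  \<open>x \<mapsto> G (1 - 1/p + x/p)\<close> belongs to a variable \<open>\<zeta>\<^sub>p\<close>, then substituting \<open>x = 1 - p s\<close> gives
  \<open>G (1 - s) = E ((1 - p s) ^ \<zeta>\<^sub>p)\<close>: the variable \<open>\<zeta>\<close> arises from \<open>\<zeta>\<^sub>p\<close> by keeping each of its
  \<open>\<zeta>\<^sub>p\<close> points independently with probability \<open>p\<close>. A Poisson mixture is what such a thinning
  looks like in the limit \<open>p \<rightarrow> 0\<close>.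

  Suppose that \<open>\<zeta>\<close> is \<open>p\<close>-thickable for all \<open>p\<close>. Since \<open>(1 - u) ^ n\<close> and \<open>exp (- u n)\<close> differ by at
  most \<open>2 u\<close>, uniformly in \<open>n\<close> (\<open>exp_minus_power_bounds\<close>), the function \<open>s \<mapsto> G (1 - s)\<close> is the limit,
  on \<open>[0, 1]\<close>, of the Laplace transforms of the variables \<open>p \<zeta>\<^sub>p\<close> as \<open>p \<rightarrow> 0\<close>. It tends to \<open>1\<close> at \<open>0\<close>,
  so these variables are tight, and by Helly's selection theorem a subsequence of their laws
  converges weakly to a law \<open>Q\<close> on the half-line. Its Laplace transform is \<open>G (1 - s)\<close>
  (\<open>laplace_limit\<close>), which says that \<open>G (x) = \<integral> exp (t (x - 1)) Q(dt)\<close>.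

  Conversely, let \<open>G\<close> have this form. Thickening a Poisson law multiplies its rate by \<open>1/p\<close>, so the
  mixture of the Poisson laws of rate \<open>t/p\<close> is the candidate for the law of \<open>\<zeta>\<^sub>p\<close>. If \<open>H\<close> is its
  generating function, then \<open>G (y) = H (1 - p (1 - y))\<close> on \<open>[0, 1]\<close>, and the affine map
  \<open>y \<mapsto> 1 - p (1 - y)\<close> carries \<open>[1 - 1/p, 1]\<close> onto \<open>[0, 1]\<close>. Hence the power series of \<open>H\<close> at \<open>0\<close>,
  read as an expansion of \<open>G\<close> about the left end point \<open>1 - 1/p\<close>, is the analytic continuation of
  \<open>G\<close> all the way down to that point (\<open>gf_extension_thickening\<close>).

  That being a Poisson mixture can be expressed equally by the weights and by the generating function
  (\<open>cox_distributed_iff_laplace\<close>) is termwise integration of the exponential series together with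
  the uniqueness of the coefficients of a power series.
\<close>

section \<open>Mixtures of Poisson laws\<close>

lemma pmf_poisson0_pmf:
  assumes "0 \<le> t"
  shows "pmf (poisson0_pmf t) k = t ^ k / fact k * exp (- t)"
  using assms by (cases k) (auto simp: poisson0_pmf_def)

lemma poisson0_pmf_gf_sums:
  assumes "0 \<le> t"
  shows "(\<lambda>k. pmf (poisson0_pmf t) k * x ^ k) sums exp (t * (x - 1))"
proof -
  have "(\<lambda>k. exp (- t) * ((t * x) ^ k /\<^sub>R fact k)) sums (exp (- t) * exp (t * x))"
    by (intro sums_mult exp_converges)
  then show ?thesis
    using assms
    by (simp add: pmf_poisson0_pmf power_mult_distrib divide_inverse mult_ac exp_add[symmetric] algebra_simps)
qed

lemma space_nonneg: "prob_measure_on_nonneg Q \<Longrightarrow> space Q = {0..}"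
  unfolding prob_measure_on_nonneg_def
  by (metis sets_eq_imp_space_eq space_borel space_restrict_space inf_top_right)

lemma borel_measurable_nonneg:
  assumes "prob_measure_on_nonneg Q" and "f \<in> borel_measurable borel"
  shows "f \<in> borel_measurable Q"
proof -
  have "sets Q = sets (restrict_space borel {0..})"
    using assms(1) by (simp add: prob_measure_on_nonneg_def)
  then show ?thesis
    using measurable_restrict_space1[OF assms(2), of "{0..}"] by (simp cong: measurable_cong_sets)
qed

lemma integrable_poisson_weight:
  assumes Q: "prob_measure_on_nonneg Q" and "0 \<le> r"
  shows "integrable Q (\<lambda>t. pmf (poisson0_pmf (r * t)) k)"
proof -
  interpret prob_space Q using Q by (simp add: prob_measure_on_nonneg_def)
  have "(\<lambda>t. (r * t) ^ k / fact k * exp (- (r * t))) \<in> borel_measurable Q"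
    by (rule borel_measurable_nonneg[OF Q]) measurable
  also have "?this \<longleftrightarrow> (\<lambda>t. pmf (poisson0_pmf (r * t)) k) \<in> borel_measurable Q"
    using \<open>0 \<le> r\<close> by (intro measurable_cong) (simp add: pmf_poisson0_pmf space_nonneg[OF Q])
  finally show ?thesis
    by (intro integrable_const_bound[where B = 1]) (auto simp: pmf_le_1)
qed

text \<open>
  The exponential series in \<open>r t x\<close>, integrated term by term. The exchange is legitimate because all
  terms are nonnegative and the partial sums are bounded by the value \<open>exp (r t (x - 1)) \<le> 1\<close>. The
  scaling \<open>r\<close> of the rate is \<open>1\<close> for the mixture itself and \<open>1/p\<close> for its thickening.
\<close>

lemma mixed_poisson_gf_sums:
  assumes Q: "prob_measure_on_nonneg Q" and r: "0 \<le> r" and x: "x \<in> {0..1}"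
  shows "(\<lambda>k. (\<integral>t. pmf (poisson0_pmf (r * t)) k \<partial>Q) * x ^ k) sums (\<integral>t. exp (r * t * (x - 1)) \<partial>Q)"
proof -
  interpret prob_space Q using Q by (simp add: prob_measure_on_nonneg_def)
  define f where "f = (\<lambda>k t. pmf (poisson0_pmf (r * t)) k * x ^ k)"
  have pt: "(\<lambda>k. f k t) sums exp (r * t * (x - 1))" if "t \<in> space Q" for t
    unfolding f_def using that r by (intro poisson0_pmf_gf_sums) (simp add: space_nonneg[OF Q])
  have nn: "0 \<le> f k t" for k t using x by (simp add: f_def)
  have int: "integrable Q (f k)" for k
    unfolding f_def by (intro integrable_mult_left integrable_poisson_weight[OF Q r])
  have "(\<Sum>k<n. \<integral>t. f k t \<partial>Q) \<le> 1" for n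
  proof -
    have "(\<Sum>k<n. f k t) \<le> 1" if t: "t \<in> space Q" for t
    proof -
      have "(\<Sum>k<n. f k t) \<le> exp (r * t * (x - 1))"
        using sum_le_suminf[of "\<lambda>k. f k t" "{..<n}"] pt[OF t] nn by (simp add: sums_iff)
      also have "\<dots> \<le> 1"
        using r x t by (simp add: space_nonneg[OF Q] mult_nonneg_nonpos)
      finally show ?thesis .
    qed
    then have "(\<integral>t. (\<Sum>k<n. f k t) \<partial>Q) \<le> (\<integral>t. 1 \<partial>Q)"
      using int by (intro integral_mono) auto
    then show ?thesis using int by (simp add: prob_space)
  qed
  then have summ: "summable (\<lambda>k. \<integral>t. f k t \<partial>Q)"
    by (intro summableI_nonneg_bounded[where x = 1]) (auto simp: nn)
  have "(\<lambda>k. integral\<^sup>L Q (f k)) sums (\<integral>t. (\<Sum>k. f k t) \<partial>Q)"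
    by (rule sums_integral)
       (use int pt summ nn in \<open>auto intro!: AE_I2 dest: sums_summable\<close>)
  also have "(\<integral>t. (\<Sum>k. f k t) \<partial>Q) = (\<integral>t. exp (r * t * (x - 1)) \<partial>Q)"
    using pt by (intro Bochner_Integration.integral_cong) (auto simp: sums_iff)
  finally show ?thesis by (simp add: f_def)
qed

section \<open>Coefficients determine and are determined by the generating function\<close>

text \<open>
  The equality is known on the right of \<open>0\<close> only; that is enough because the zeros of a nonzero power
  series cannot accumulate at its centre.
\<close>

lemma power_series_unique:
  fixes a b :: "nat \<Rightarrow> real"
  assumes a: "\<And>x. x \<in> {0..1} \<Longrightarrow> (\<lambda>k. a k * x ^ k) sums f x"
    and b: "\<And>x. x \<in> {0..1} \<Longrightarrow> (\<lambda>k. b k * x ^ k) sums f x"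
  shows "a k = b k"
proof (rule ccontr)
  assume k: "a k \<noteq> b k"
  define d where "d k = a k - b k" for k
  have d: "(\<lambda>k. d k * x ^ k) sums 0" if "x \<in> {0..1}" for x
    using sums_diff[OF a[OF that] b[OF that]] by (simp add: d_def algebra_simps)
  \<comment> \<open>The constant term needs a separate argument: isolation of the zero at the centre requires a
    nonzero coefficient of positive index.\<close>
  have "d 0 = 0" using d[of 0] by simp
  then have "0 < k" using k by (auto simp: d_def intro: gr0I)
  have "summable (\<lambda>k. d k * x ^ k)" if "\<bar>x\<bar> < 1" for x
    using powser_inside[of d 1 x] sums_summable[OF d[of 1]] that by simp
  then have "(\<lambda>k. d k * (x - 0) ^ k) sums (\<Sum>k. d k * x ^ k)" if "norm (x - 0) < 1" for x
    using that by auto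
  then obtain s where s: "0 < s" "\<And>z. z \<in> cball 0 s - {0} \<Longrightarrow> (\<Sum>k. d k * z ^ k) \<noteq> 0"
    using powser_0_nonzero[of 1 0 d "\<lambda>x. \<Sum>k. d k * x ^ k" k] k \<open>0 < k\<close> \<open>d 0 = 0\<close>
    by (auto simp: d_def)
  have "(\<Sum>k. d k * (min s 1) ^ k) = 0"
    using d[of "min s 1"] s(1) by (auto simp: sums_iff)
  then show False using s(2)[of "min s 1"] s(1) by auto
qed

lemma pmf_of_weights:
  fixes a :: "nat \<Rightarrow> real"
  assumes "\<And>k. 0 \<le> a k" and "a sums 1"
  obtains q where "\<And>k. pmf q k = a k"
proof
  have "(\<integral>\<^sup>+ k. ennreal (a k) \<partial>count_space UNIV) = 1"
    using assms by (simp add: nn_integral_count_space_nat suminf_ennreal2 sums_iff)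
  then show "pmf (embed_pmf a) k = a k" for k
    using assms(1) by (intro pmf_embed_pmf) auto
qed

lemma gf_pmf: "gf (measure_pmf q) (\<lambda>k. k) x = (\<Sum>k. pmf q k * x ^ k)"
  by (simp add: gf_def pmf.rep_eq)

lemma cox_distributed_iff_laplace:
  assumes M: "prob_space M" "\<zeta> \<in> measurable M (count_space UNIV)"
  shows "cox_distributed M \<zeta> \<longleftrightarrow>
    (\<exists>Q. prob_measure_on_nonneg Q \<and> (\<forall>x\<in>{0..1}. gf M \<zeta> x = (\<integral>t. exp (t * (x - 1)) \<partial>Q)))"
proof -
  have "(\<forall>k. \<P>(\<omega> in M. \<zeta> \<omega> = k) = (\<integral>t. pmf (poisson0_pmf t) k \<partial>Q)) \<longleftrightarrow>
      (\<forall>x\<in>{0..1}. gf M \<zeta> x = (\<integral>t. exp (t * (x - 1)) \<partial>Q))" (is "?coeffs \<longleftrightarrow> ?gf")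
    if Q: "prob_measure_on_nonneg Q" for Q
  proof
    note mix = mixed_poisson_gf_sums[OF Q zero_le_one, simplified mult_1]
    show ?gf if ?coeffs
      using mix that by (simp add: gf_def sums_iff)
    assume eq: ?gf
    show ?coeffs
    proof
      fix k
      show "\<P>(\<omega> in M. \<zeta> \<omega> = k) = (\<integral>t. pmf (poisson0_pmf t) k \<partial>Q)"
      proof (rule power_series_unique[where f = "gf M \<zeta>"])
        show "(\<lambda>k. \<P>(\<omega> in M. \<zeta> \<omega> = k) * x ^ k) sums gf M \<zeta> x" if "x \<in> {0..1}" for x
          using gf_sums_expectation[OF M that] by (simp add: gf_def sums_iff)
        show "(\<lambda>k. (\<integral>t. pmf (poisson0_pmf t) k \<partial>Q) * x ^ k) sums gf M \<zeta> x" if "x \<in> {0..1}" for x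
          using mix[OF that] eq that by simp
      qed
    qed
  qed
  then show ?thesis unfolding cox_distributed_def by blast
qed

section \<open>Thickening a Poisson mixture\<close>

text \<open>
  A thinning identity on \<open>[0, 1]\<close> extends the generating function by itself: its left-hand side is a
  power series composed with an affine map that sends \<open>(1 - 1/p, 1)\<close> into the open unit disc, hence
  analytic there. Continuity up to the end points is Abel's theorem, as the coefficients are summable.
\<close>

lemma gf_extension_thickening:
  assumes p: "0 < p" "p < 1"
    and q: "\<And>y. y \<in> {0..1} \<Longrightarrow> gf (measure_pmf q) (\<lambda>k. k) (1 - p * (1 - y)) = gf M \<zeta> y"
  shows "gf_extension M \<zeta> (1 - 1 / p) (\<lambda>y. gf (measure_pmf q) (\<lambda>k. k) (1 - p * (1 - y)))"
proof -
  define H where "H = gf (measure_pmf q) (\<lambda>k. k)"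
  have H: "H = (\<lambda>x. \<Sum>k. pmf q k * x ^ k)" by (auto simp: H_def gf_pmf)
  have summ: "summable (pmf q)"
    using gf_sums_expectation[OF prob_space_measure_pmf[of q], of "\<lambda>k. k" 1]
    by (auto simp: pmf.rep_eq dest: sums_summable)
  have into: "1 - p * (1 - y) \<in> {0..1}" if "y \<in> {1 - 1 / p..1}" for y
    using that p by (auto simp: field_simps)
  have into': "1 - p * (1 - y) \<in> {0<..<1}" if "y \<in> {1 - 1 / p<..<1}" for y
    using that p by (auto simp: field_simps)
  have cont: "continuous_on {1 - 1 / p..1} (\<lambda>y. H (1 - p * (1 - y)))"
    unfolding H
    by (rule continuous_on_compose2[OF Abel_limit[OF summ]])
       (use into in \<open>auto intro!: continuous_intros\<close>)
  define F where "F z = (\<Sum>k. complex_of_real (pmf q k) * z ^ k)" for z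
  have csum: "summable (\<lambda>k. complex_of_real (pmf q k) * z ^ k)" if "norm z < 1" for z
    by (rule powser_inside[of _ 1]) (use that summ in \<open>auto simp: summable_complex_of_real\<close>)
  have hol: "F holomorphic_on ball 0 1"
    by (rule power_series_holomorphic[of 0 _ "\<lambda>k. complex_of_real (pmf q k)"])
       (use csum in \<open>auto simp: F_def dest: summable_sums\<close>)
  define S where "S = (\<lambda>z. 1 - complex_of_real p * (1 - z)) -` ball 0 1"
  have "open S" unfolding S_def by (intro open_vimage open_ball continuous_intros)
  have image: "1 - complex_of_real p * (1 - complex_of_real y) = complex_of_real (1 - p * (1 - y))" for y
    by simp
  have "(F \<circ> (\<lambda>z. 1 - complex_of_real p * (1 - z))) holomorphic_on S"
    by (rule holomorphic_on_compose_gen[OF _ hol]) (auto simp: S_def intro!: holomorphic_intros)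
  moreover have "complex_of_real ` {1 - 1 / p<..<1} \<subseteq> S"
  proof safe
    fix y assume y: "y \<in> {1 - 1 / p<..<1}"
    have "cmod (1 - complex_of_real p * (1 - complex_of_real y)) = \<bar>1 - p * (1 - y)\<bar>"
      unfolding image norm_of_real ..
    then show "complex_of_real y \<in> S" using into'[OF y] by (simp add: S_def)
  qed
  ultimately have an: "(F \<circ> (\<lambda>z. 1 - complex_of_real p * (1 - z))) analytic_on complex_of_real ` {1 - 1 / p<..<1}"
    using \<open>open S\<close> by (auto simp: analytic_on_holomorphic)
  have eq: "(F \<circ> (\<lambda>z. 1 - complex_of_real p * (1 - z))) (complex_of_real y) = complex_of_real (H (1 - p * (1 - y)))"
    if "y \<in> {1 - 1 / p<..<1}" for y
  proof -
    define x where "x = 1 - p * (1 - y)"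
    have "summable (\<lambda>k. complex_of_real (pmf q k) * complex_of_real x ^ k)"
      using into'[OF that] by (intro csum) (simp only: norm_of_real x_def, auto)
    then have "summable (\<lambda>k. pmf q k * x ^ k)"
      by (simp flip: of_real_power of_real_mult)
    then have "F (complex_of_real x) = complex_of_real (H x)"
      by (simp add: F_def H suminf_of_real)
    then show ?thesis by (simp only: comp_def image x_def)
  qed
  show ?thesis
    unfolding gf_extension_def H_def[symmetric]
    using cont an eq q by (auto simp: H_def[symmetric])
qed

lemma laplace_imp_thickable:
  assumes Q: "prob_measure_on_nonneg Q"
    and gf: "\<And>x. x \<in> {0..1} \<Longrightarrow> gf M \<zeta> x = (\<integral>t. exp (t * (x - 1)) \<partial>Q)"
    and p: "0 < p" "p < 1"
  shows "thickable p M \<zeta>"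
proof -
  interpret prob_space Q using Q by (simp add: prob_measure_on_nonneg_def)
  have mix: "(\<lambda>k. (\<integral>t. pmf (poisson0_pmf (1 / p * t)) k \<partial>Q) * x ^ k)
      sums (\<integral>t. exp (1 / p * t * (x - 1)) \<partial>Q)" if "x \<in> {0..1}" for x
    using p by (intro mixed_poisson_gf_sums[OF Q _ that]) auto
  obtain q where q: "\<And>k. pmf q k = (\<integral>t. pmf (poisson0_pmf (1 / p * t)) k \<partial>Q)"
  proof (rule pmf_of_weights)
    show "(\<lambda>k. \<integral>t. pmf (poisson0_pmf (1 / p * t)) k \<partial>Q) sums 1"
      using mix[of 1] by (simp add: prob_space)
  qed auto
  have q_gf: "gf (measure_pmf q) (\<lambda>k. k) x = (\<integral>t. exp (1 / p * t * (x - 1)) \<partial>Q)" if "x \<in> {0..1}" for x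
    using mix[OF that] by (simp add: gf_pmf q sums_iff)
  have thin: "gf (measure_pmf q) (\<lambda>k. k) (1 - p * (1 - y)) = gf M \<zeta> y" if y: "y \<in> {0..1}" for y
  proof -
    have "p * (1 - y) \<le> 1" using y p by (intro mult_le_one) auto
    then have "1 - p * (1 - y) \<in> {0..1}" using y p by auto
    then show ?thesis
      using p y by (simp add: q_gf gf mult_ac right_diff_distrib)
  qed
  have "1 - p * (1 - (1 - 1 / p + 1 / p * x)) = x" for x
    using p by (simp add: field_simps)
  then show ?thesis
    unfolding thickable_def using gf_extension_thickening[OF p thin] by fastforce
qed

section \<open>Limits of Laplace transforms\<close>

text \<open>
  The error is uniform in \<open>n\<close> because \<open>1 - u\<close> is at least \<open>exp (- u - 2 u\<^sup>2)\<close>, so that the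
  relative error is at most \<open>2 u\<^sup>2 n\<close>, while \<open>u n exp (- u n) \<le> 1\<close> absorbs the factor \<open>u n\<close>.
\<close>

lemma exp_minus_power_bounds:
  fixes u :: real
  assumes "0 \<le> u" "u \<le> 1 / 2"
  shows "(1 - u) ^ n \<le> exp (- (u * n))" and "exp (- (u * n)) \<le> (1 - u) ^ n + 2 * u"
proof -
  have pow: "(1 - u) ^ n = exp (n * ln (1 - u))"
    using assms by (simp add: exp_of_nat_mult)
  have "ln (1 - u) \<le> - u" using ln_le_minus_one[of "1 - u"] assms by simp
  then have "n * ln (1 - u) \<le> n * (- u)" by (intro mult_left_mono) auto
  then show "(1 - u) ^ n \<le> exp (- (u * n))" by (simp add: pow mult.commute)
  have "u * n \<le> exp (u * n)" using exp_ge_add_one_self[of "u * n"] by linarith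
  then have "u * n * exp (- (u * n)) \<le> 1" by (simp add: exp_minus field_simps)
  then have 1: "2 * u * (u * n * exp (- (u * n))) \<le> 2 * u * 1"
    using assms by (intro mult_left_mono) auto
  have "1 - 2 * u\<^sup>2 * n \<le> exp (- (2 * u\<^sup>2 * n))"
    using exp_ge_add_one_self[of "- (2 * u\<^sup>2 * n)"] by simp
  then have "exp (- (u * n)) * (1 - 2 * u\<^sup>2 * n) \<le> exp (- (u * n)) * exp (- (2 * u\<^sup>2 * n))"
    by (intro mult_left_mono) auto
  also have "\<dots> = exp (n * (- u - 2 * u\<^sup>2))"
    by (simp add: algebra_simps flip: exp_add)
  also have "\<dots> \<le> exp (n * ln (1 - u))"
    using ln_one_minus_pos_lower_bound[OF assms] by (intro exp_mono mult_left_mono) auto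
  finally show "exp (- (u * n)) \<le> (1 - u) ^ n + 2 * u"
    using 1 unfolding pow by (simp add: power2_eq_square algebra_simps)
qed

lemma integrable_laplace:
  assumes "real_distribution \<mu>" and "AE t in \<mu>. 0 \<le> t" and "0 \<le> s"
  shows "integrable \<mu> (\<lambda>t. exp (- (s * t)))"
proof -
  interpret real_distribution \<mu> by fact
  show ?thesis
    by (rule integrable_const_bound[where B = 1])
       (use assms(2,3) in \<open>auto elim!: eventually_mono\<close>)
qed

text \<open>
  The value of a Laplace transform at a small \<open>s\<close> controls the mass beyond \<open>1/s\<close>: there
  \<open>exp (- s t) \<le> 1/2\<close>, so the mass of \<open>[0, 1/s]\<close> is at least \<open>2 E (exp (- s t)) - 1\<close>. A lower bound
  valid for all members of the sequence and tending to \<open>1\<close> therefore keeps mass from escaping to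
  infinity.
\<close>

lemma tight_of_laplace_lower_bound:
  assumes \<mu>: "\<And>n. real_distribution (\<mu> n)" and pos: "\<And>n. AE t in \<mu> n. 0 \<le> t"
    and lower: "\<And>n s. s \<in> {0..1} \<Longrightarrow> \<phi> s \<le> (\<integral>t. exp (- (s * t)) \<partial>\<mu> n)"
    and \<phi>: "(\<phi> \<longlongrightarrow> 1) (at_right 0)"
  shows "tight \<mu>"
  unfolding tight_def
proof (intro conjI allI impI \<mu>)
  fix \<epsilon> :: real assume "0 < \<epsilon>"
  have "\<forall>\<^sub>F s in at_right 0. 1 - \<epsilon> / 2 < \<phi> s"
    using \<open>0 < \<epsilon>\<close> by (intro order_tendstoD(1)[OF \<phi>]) auto
  moreover have "\<forall>\<^sub>F s in at_right 0. s \<in> {0<..<1::real}"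
    by (rule eventually_at_right_real) simp
  ultimately have "\<forall>\<^sub>F s in at_right 0. 1 - \<epsilon> / 2 < \<phi> s \<and> 0 < s \<and> s < 1"
    by eventually_elim auto
  then obtain s where s: "1 - \<epsilon> / 2 < \<phi> s" "0 < s" "s < 1"
    using eventually_happens'[OF trivial_limit_at_right_real] by blast
  show "\<exists>a b. a < b \<and> (\<forall>n. 1 - \<epsilon> < measure (\<mu> n) {a<..b})"
  proof (intro exI conjI allI)
    show "- 1 < 1 / s" using s by (simp add: less_trans[of _ 0])
    fix n
    interpret real_distribution "\<mu> n" by (rule \<mu>)
    have int: "integrable (\<mu> n) (\<lambda>t. exp (- (s * t)))"
      using \<mu> pos s by (intro integrable_laplace) auto
    have "2 * exp (- (s * t)) - 1 \<le> indicator {-1<..1 / s} t" if "0 \<le> t" for t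
    proof (cases "t \<le> 1 / s")
      case True
      then show ?thesis using that s by simp
    next
      case False
      then have "1 < s * t" using s by (simp add: field_simps)
      then have "2 \<le> exp (s * t)" using exp_ge_add_one_self[of "s * t"] by linarith
      then show ?thesis using False by (simp add: exp_minus field_simps)
    qed
    then have "AE t in \<mu> n. 2 * exp (- (s * t)) - 1 \<le> indicator {-1<..1 / s} t"
      using pos[of n] by (auto elim!: eventually_mono)
    then have "(\<integral>t. 2 * exp (- (s * t)) - 1 \<partial>\<mu> n) \<le> (\<integral>t. indicator {-1<..1 / s} t \<partial>\<mu> n)"
      using int by (intro integral_mono_AE) (auto simp: less_top[symmetric])
    then have "2 * (\<integral>t. exp (- (s * t)) \<partial>\<mu> n) - 1 \<le> measure (\<mu> n) {-1<..1 / s}"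
      using int prob_space by simp
    then show "1 - \<epsilon> < measure (\<mu> n) {-1<..1 / s}"
      using lower[of s n] s by auto
  qed
qed

text \<open>
  A form of the continuity theorem for Laplace transforms, in which the limit measure is produced by
  compactness instead of being given.
\<close>

lemma laplace_limit:
  assumes \<mu>: "\<And>n. real_distribution (\<mu> n)" and pos: "\<And>n. AE t in \<mu> n. 0 \<le> t"
    and lower: "\<And>n s. s \<in> {0..1} \<Longrightarrow> \<phi> s \<le> (\<integral>t. exp (- (s * t)) \<partial>\<mu> n)"
    and lim: "\<And>s. s \<in> {0..1} \<Longrightarrow> (\<lambda>n. \<integral>t. exp (- (s * t)) \<partial>\<mu> n) \<longlonglongrightarrow> \<phi> s"
    and \<phi>: "(\<phi> \<longlongrightarrow> 1) (at_right 0)"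
  obtains Q where "prob_measure_on_nonneg Q" and "\<And>s. s \<in> {0..1} \<Longrightarrow> \<phi> s = (\<integral>t. exp (- (s * t)) \<partial>Q)"
proof -
  have "tight \<mu>" using \<mu> pos lower \<phi> by (rule tight_of_laplace_lower_bound)
  from tight_imp_convergent_subsubsequence[OF this strict_mono_id] obtain r N
    where r: "strict_mono (r :: nat \<Rightarrow> nat)" and N: "real_distribution N"
      and weak: "weak_conv_m (\<mu> \<circ> r) N" by auto
  interpret N: real_distribution N by (rule N)
  have conv: "(\<lambda>n. integral\<^sup>L (\<mu> (r n)) f) \<longlonglongrightarrow> integral\<^sup>L N f"
    if "\<And>x. isCont f x" "\<And>x. \<bar>f x\<bar> \<le> 1" for f :: "real \<Rightarrow> real"
    using weak_conv_imp_integral_bdd_continuous_conv[of "\<mu> \<circ> r" N f 1] \<mu> N weak that by simp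
  \<comment> \<open>A bounded continuous test function that is positive exactly on the negative half-line; it
    carries the information that there is no mass there to the weak limit.\<close>
  define g :: "real \<Rightarrow> real" where "g t = min 1 (max 0 (- t))" for t
  have g_nonneg: "0 \<le> g t" for t by (simp add: g_def)
  have "(\<integral>t. g t \<partial>\<mu> n) = 0" for n
    using pos[of n] by (intro integral_eq_zero_AE) (auto simp: g_def elim!: eventually_mono)
  moreover have "(\<lambda>n. \<integral>t. g t \<partial>\<mu> (r n)) \<longlonglongrightarrow> (\<integral>t. g t \<partial>N)"
    by (rule conv) (auto simp: g_def intro!: continuous_intros)
  ultimately have "(\<integral>t. g t \<partial>N) = 0" by (simp add: LIMSEQ_const_iff)
  moreover have "integrable N g"
    unfolding g_def by (rule N.integrable_const_bound[where B = 1]) auto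
  ultimately have "AE t in N. g t = 0"
    using integral_nonneg_eq_0_iff_AE[of N g] by (simp add: g_nonneg)
  then have Npos: "AE t in N. 0 \<le> t" by (rule eventually_mono) (auto simp: g_def min_def max_def split: if_splits)
  define Q where "Q = restrict_space N {0..}"
  have "N.prob {0..} = 1" using Npos by (subst N.prob_eq_1) auto
  then have "prob_space Q" unfolding Q_def
    by (intro prob_space_restrict_space) (auto simp: N.emeasure_eq_measure)
  moreover have "sets Q = sets (restrict_space borel {0..})"
    by (simp add: Q_def sets_restrict_space)
  ultimately have Q: "prob_measure_on_nonneg Q" by (simp add: prob_measure_on_nonneg_def)
  have "\<phi> s = (\<integral>t. exp (- (s * t)) \<partial>Q)" if s: "s \<in> {0..1}" for s
  proof (rule LIMSEQ_unique)
    have meas: "(\<lambda>t. exp (- (s * t))) \<in> borel_measurable (\<mu> n)" "(\<lambda>t. exp (- (s * max 0 t))) \<in> borel_measurable (\<mu> n)" for n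
    proof -
      interpret real_distribution "\<mu> n" by (rule \<mu>)
      show "(\<lambda>t. exp (- (s * t))) \<in> borel_measurable (\<mu> n)" "(\<lambda>t. exp (- (s * max 0 t))) \<in> borel_measurable (\<mu> n)"
        by measurable
    qed
    show "(\<lambda>n. \<integral>t. exp (- (s * t)) \<partial>\<mu> (r n)) \<longlonglongrightarrow> \<phi> s"
      using LIMSEQ_subseq_LIMSEQ[OF lim[OF s] r] by (simp add: comp_def)
    \<comment> \<open>Weak convergence tests functions bounded on the whole line, so the exponential is cut off on the
      negative half-line, where none of the measures has mass.\<close>
    have "(\<lambda>n. \<integral>t. exp (- (s * max 0 t)) \<partial>\<mu> (r n)) \<longlonglongrightarrow> (\<integral>t. exp (- (s * max 0 t)) \<partial>N)"
      using s by (intro conv) (auto intro!: continuous_intros)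
    also have "(\<integral>t. exp (- (s * max 0 t)) \<partial>N) = (\<integral>t. indicator {0..} t *\<^sub>R exp (- (s * t)) \<partial>N)"
      using Npos by (intro integral_cong_AE) (auto elim!: eventually_mono)
    also have "\<dots> = (\<integral>t. exp (- (s * t)) \<partial>Q)"
      unfolding Q_def by (subst integral_restrict_space) auto
    also have "(\<lambda>n. \<integral>t. exp (- (s * max 0 t)) \<partial>\<mu> (r n)) = (\<lambda>n. \<integral>t. exp (- (s * t)) \<partial>\<mu> (r n))"
    proof
      fix n
      show "(\<integral>t. exp (- (s * max 0 t)) \<partial>\<mu> (r n)) = (\<integral>t. exp (- (s * t)) \<partial>\<mu> (r n))"
        by (intro integral_cong_AE meas) (rule eventually_mono[OF pos[of "r n"]], simp)
    qed
    finally show "(\<lambda>n. \<integral>t. exp (- (s * t)) \<partial>\<mu> (r n)) \<longlonglongrightarrow> (\<integral>t. exp (- (s * t)) \<partial>Q)" .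
  qed
  with Q show ?thesis by (rule that)
qed

section \<open>Arbitrarily thickable laws are Poisson mixtures\<close>

lemma thickable_imp_thinning:
  assumes "thickable p M \<zeta>" and p: "0 < p" "p < 1"
  obtains q :: "nat pmf" where "\<And>s. s \<in> {0..1} \<Longrightarrow> gf M \<zeta> (1 - s) = (\<integral>k. (1 - p * s) ^ k \<partial>measure_pmf q)"
proof -
  obtain G q where G: "gf_extension M \<zeta> (1 - 1 / p) G"
    and q: "\<And>x. x \<in> {0..1} \<Longrightarrow> G (1 - 1 / p + 1 / p * x) = gf (measure_pmf q) (\<lambda>k. k) x"
    using assms(1) unfolding thickable_def by blast
  have "gf M \<zeta> (1 - s) = (\<integral>k. (1 - p * s) ^ k \<partial>measure_pmf q)" if s: "s \<in> {0..1}" for s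
  proof -
    have x: "1 - p * s \<in> {0..1}" using s p by (auto intro: mult_le_one)
    have "gf M \<zeta> (1 - s) = G (1 - s)" using G s by (simp add: gf_extension_def)
    also have "\<dots> = gf (measure_pmf q) (\<lambda>k. k) (1 - p * s)"
      using q[OF x] p by (simp add: diff_divide_distrib)
    also have "\<dots> = (\<integral>k. (1 - p * s) ^ k \<partial>measure_pmf q)"
      using x by (intro gf_eq_expectation prob_space_measure_pmf) auto
    finally show ?thesis .
  qed
  then show ?thesis by (rule that)
qed

lemma gf_tendsto_1:
  assumes M: "prob_space M" "\<zeta> \<in> measurable M (count_space UNIV)"
  shows "((\<lambda>s. gf M \<zeta> (1 - s)) \<longlongrightarrow> 1) (at_right 0)"
proof -
  interpret prob_space M by fact
  have one: "gf M \<zeta> 1 = 1" using gf_eq_expectation[OF M, of 1] by (simp add: prob_space)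
  have "summable (\<lambda>k. \<P>(\<omega> in M. \<zeta> \<omega> = k))"
    using gf_sums_expectation[OF M, of 1] by (auto dest: sums_summable)
  then have "continuous_on {0..1} (\<lambda>x. gf M \<zeta> x)" unfolding gf_def by (rule Abel_limit)
  then have "continuous_on {0..1} (\<lambda>s. gf M \<zeta> (1 - s))"
    by (rule continuous_on_compose2) (auto intro!: continuous_intros)
  then have "((\<lambda>s. gf M \<zeta> (1 - s)) \<longlongrightarrow> gf M \<zeta> (1 - 0)) (at 0 within {0..1})"
    unfolding continuous_on_def by (rule bspec) simp
  then show ?thesis by (simp add: one at_within_Icc_at_right)
qed

text \<open>
  The measures to which the limit theorem is applied are the laws of \<open>p \<zeta>\<^sub>p\<close> along a sequence
  \<open>p \<rightarrow> 0\<close>. The inequality \<open>(1 - u) ^ n \<le> exp (- u n)\<close> makes the limit a lower bound for every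
  member of the sequence of Laplace transforms, which is what tightness asks for.
\<close>

lemma thickable_imp_laplace:
  assumes M: "prob_space M" "\<zeta> \<in> measurable M (count_space UNIV)"
    and thick: "\<And>p. p \<in> {0<..<1} \<Longrightarrow> thickable p M \<zeta>"
  obtains Q where "prob_measure_on_nonneg Q"
    and "\<And>x. x \<in> {0..1} \<Longrightarrow> gf M \<zeta> x = (\<integral>t. exp (t * (x - 1)) \<partial>Q)"
proof -
  \<comment> \<open>The shift by \<open>2\<close> keeps \<open>p s\<close> within \<open>[0, 1/2]\<close>, the range of the exponential estimate.\<close>
  define p :: "nat \<Rightarrow> real" where "p n = inverse (real (n + 2))" for n
  have p: "0 < p n" "p n \<le> 1 / 2" for n by (auto simp: p_def field_simps)
  have p_lim: "p \<longlonglongrightarrow> 0"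
    unfolding p_def by (rule LIMSEQ_ignore_initial_segment[OF lim_inverse_n])
  have "\<exists>q. \<forall>s\<in>{0..1}. gf M \<zeta> (1 - s) = (\<integral>k. (1 - p n * s) ^ k \<partial>measure_pmf q)" for n
  proof -
    have "0 < p n" "p n < 1" using p[of n] by auto
    then show ?thesis using thickable_imp_thinning[OF thick[of "p n"]] by (metis greaterThanLessThan_iff)
  qed
  then obtain q where q: "\<And>n s. s \<in> {0..1} \<Longrightarrow> gf M \<zeta> (1 - s) = (\<integral>k. (1 - p n * s) ^ k \<partial>measure_pmf (q n))"
    by metis
  define \<mu> where "\<mu> n = distr (measure_pmf (q n)) borel (\<lambda>k. p n * real k)" for n
  have lap: "(\<integral>t. exp (- (s * t)) \<partial>\<mu> n) = (\<integral>k. exp (- (p n * s * real k)) \<partial>measure_pmf (q n))" for s n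
    unfolding \<mu>_def by (subst integral_distr) (auto simp: mult_ac)
  have u: "0 \<le> p n * s" "p n * s \<le> 1 / 2" "p n * s \<le> p n" if "s \<in> {0..1}" for n s
  proof -
    show "0 \<le> p n * s" "p n * s \<le> p n" using that p[of n] by (auto simp: mult_left_le)
    then show "p n * s \<le> 1 / 2" using p(2)[of n] by linarith
  qed
  have int: "integrable (measure_pmf (q n)) (\<lambda>k. (1 - p n * s) ^ k)"
    "integrable (measure_pmf (q n)) (\<lambda>k. exp (- (p n * s * real k)))" if "s \<in> {0..1}" for s n
    using u[OF that, of n]
    by (auto intro!: measure_pmf.integrable_const_bound[where B = 1] AE_I2 power_le_one)
  have lower: "gf M \<zeta> (1 - s) \<le> (\<integral>t. exp (- (s * t)) \<partial>\<mu> n)" if s: "s \<in> {0..1}" for s n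
    unfolding lap q[OF s, of n]
    by (intro integral_mono int[OF s] exp_minus_power_bounds(1) u[OF s])
  have upper: "(\<integral>t. exp (- (s * t)) \<partial>\<mu> n) \<le> gf M \<zeta> (1 - s) + 2 * p n" if s: "s \<in> {0..1}" for s n
  proof -
    have "(\<integral>t. exp (- (s * t)) \<partial>\<mu> n) \<le> (\<integral>k. (1 - p n * s) ^ k + 2 * (p n * s) \<partial>measure_pmf (q n))"
      unfolding lap
      by (intro integral_mono int[OF s] exp_minus_power_bounds(2) u[OF s] Bochner_Integration.integrable_add) auto
    also have "\<dots> = gf M \<zeta> (1 - s) + 2 * (p n * s)"
      using int[OF s] by (simp add: q[OF s, of n])
    finally show ?thesis using u(3)[OF s, of n] by linarith
  qed
  obtain Q where Q: "prob_measure_on_nonneg Q"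
    and eq: "\<And>s. s \<in> {0..1} \<Longrightarrow> gf M \<zeta> (1 - s) = (\<integral>t. exp (- (s * t)) \<partial>Q)"
  proof (rule laplace_limit)
    show "real_distribution (\<mu> n)" for n
      unfolding \<mu>_def by (rule prob_space.real_distribution_distr[OF prob_space_measure_pmf]) simp
    show "AE t in \<mu> n. 0 \<le> t" for n
      unfolding \<mu>_def using p(1)[of n] by (subst AE_distr_iff) auto
    show "(\<lambda>n. \<integral>t. exp (- (s * t)) \<partial>\<mu> n) \<longlonglongrightarrow> gf M \<zeta> (1 - s)" if s: "s \<in> {0..1}" for s
    proof (rule tendsto_sandwich[where f = "\<lambda>n. gf M \<zeta> (1 - s)"])
      show "(\<lambda>n. gf M \<zeta> (1 - s) + 2 * p n) \<longlonglongrightarrow> gf M \<zeta> (1 - s)"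
        using tendsto_add[OF tendsto_const tendsto_mult_right_zero[OF p_lim]] by auto
    qed (use lower[OF s] upper[OF s] in \<open>auto intro!: always_eventually\<close>)
  qed (use lower gf_tendsto_1[OF M] in auto)
  have "gf M \<zeta> x = (\<integral>t. exp (t * (x - 1)) \<partial>Q)" if "x \<in> {0..1}" for x
    using eq[of "1 - x"] that by (simp add: algebra_simps)
  with Q show ?thesis by (rule that)
qed

text \<open>
  Both equivalences pass through the representation of the generating function by \<open>Q\<close>.
\<close>

theorem theorem1:
  fixes M :: "'a measure" and \<zeta> :: "'a \<Rightarrow> nat"
  assumes "prob_space M"
    and "\<zeta> \<in> measurable M (count_space UNIV)"
  shows "((\<forall>p\<in>{0<..<1}. thickable p M \<zeta>) \<longleftrightarrow> cox_distributed M \<zeta>) \<and>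
         (cox_distributed M \<zeta> \<longleftrightarrow>
           (\<exists>Q. prob_measure_on_nonneg Q \<and>
              (\<forall>x\<in>{0..1}. gf M \<zeta> x = (\<integral>t. exp (t * (x - 1)) \<partial>Q))))"
  unfolding cox_distributed_iff_laplace[OF assms]
  using thickable_imp_laplace[OF assms] laplace_imp_thickable[of _ M \<zeta>]
  by (auto; metis)

end
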